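(* For every $\epsilon>0$ and every real $c \geq 1$, there exists an $n_0$ such that, for all $n \geq n_0$, every family $\mathcal{G} = \{G_1, \dots, G_n\}$ of spanning subgraphs of the complete graph $K_{2n}$ in which each $G_i$ has minimum degree at least $cn$ contains at least $\left\lfloor\frac{cn}{2+\epsilon} \right\rfloor !$ distinct perfect matching transversals.
   Context: All graphs are finite and simple; $[n]=\{1,\dots,n\}$. The members of a family $\mathcal G=\{G_1,\dots,G_n\}$ of subgraphs of a graph $G$ (here $G=K_{2n}$) are indexed and not necessarily distinct. A $\mathcal G$-transversal is a pair $(T,\phi)$ where $T\subseteq E(G)$ and $\phi:T\to[n]$ is a bijection with $e\in E(G_{\phi(e)})$ for every $e\in T$. It is a perfect matching transversal if $T$ is a perfect matching on $V(G)$. Transversals are distinct if they are distinct as pairs. *)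

theory Defs
  imports Complex_Main "HOL-Library.FuncSet"
begin

text \<open>A graph is a pair of a vertex set and a set of edges, an edge being a two-element set of
  vertices. Subgraphs of simple graphs are simple because only their edge sets can shrink.\<close>

type_synonym 'a graph = "'a set \<times> 'a set set"

abbreviation verts :: "'a graph \<Rightarrow> 'a set" where
  "verts G \<equiv> fst G"

abbreviation edges :: "'a graph \<Rightarrow> 'a set set" where
  "edges G \<equiv> snd G"

definition complete_graph :: "'a set \<Rightarrow> 'a graph" where
  "complete_graph V = (V, {e. e \<subseteq> V \<and> card e = 2})"

definition spanning_subgraph :: "'a graph \<Rightarrow> 'a graph \<Rightarrow> bool" where
  "spanning_subgraph H G \<longleftrightarrow> verts H = verts G \<and> edges H \<subseteq> edges G"

definition degree :: "'a graph \<Rightarrow> 'a \<Rightarrow> nat" where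
  "degree G v = card {e \<in> edges G. v \<in> e}"

text \<open>Only meaningful for graphs with a finite, nonempty vertex set.\<close>

definition min_degree :: "'a graph \<Rightarrow> nat" where
  "min_degree G = Min (degree G ` verts G)"

definition perfect_matching_on :: "'a set \<Rightarrow> 'a set set \<Rightarrow> bool" where
  "perfect_matching_on V M \<longleftrightarrow> (\<forall>e\<in>M. e \<subseteq> V \<and> card e = 2) \<and> (\<forall>v\<in>V. \<exists>!e. e \<in> M \<and> v \<in> e)"

text \<open>A map \<open>\<phi> : T \<rightarrow> [n]\<close> is a total function that is \<open>undefined\<close> outside \<open>T\<close>; without this
  the same transversal would be represented by many pairs and would be counted repeatedly.\<close>

definition transversal ::
  "'a graph \<Rightarrow> nat \<Rightarrow> (nat \<Rightarrow> 'a graph) \<Rightarrow> 'a set set \<times> ('a set \<Rightarrow> nat) \<Rightarrow> bool" where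
  "transversal G n \<G> = (\<lambda>(T, \<phi>).
     T \<subseteq> edges G \<and> \<phi> \<in> T \<rightarrow>\<^sub>E {1..n} \<and> bij_betw \<phi> T {1..n} \<and>
     (\<forall>e\<in>T. e \<in> edges (\<G> (\<phi> e))))"

definition perfect_matching_transversals ::
  "'a graph \<Rightarrow> nat \<Rightarrow> (nat \<Rightarrow> 'a graph) \<Rightarrow> ('a set set \<times> ('a set \<Rightarrow> nat)) set" where
  "perfect_matching_transversals G n \<G> =
     {(T, \<phi>). transversal G n \<G> (T, \<phi>) \<and> perfect_matching_on (verts G) T}"

end

theory Submission
  imports Defs "HOL-Library.Transitive_Closure_Table"
begin

text \<open>
  Two things have to be shown: that one perfect matching transversal exists, and that it can be varied in
  many ways. Write the edge of colour \<open>i\<close> in a transversal as \<open>{a i, b i}\<close>.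

  For the variation, keep \<open>a i\<close> attached to colour \<open>i\<close> and permute the other ends: every permutation \<open>\<pi>\<close> with
  \<open>{a i, b (\<pi> i)}\<close> an edge of \<open>G\<^sub>i\<close> for all \<open>i\<close> yields a new transversal. These permutations are the perfect
  matchings of a bipartite graph between colours and vertices that has the identity as one perfect matching,
  so by Marshall Hall's theorem (\<open>marshall_hall_count\<close>) there are at least \<open>k!\<close> of them when each \<open>a i\<close> has at least
  \<open>k\<close> neighbours among the \<open>b j\<close> in colour \<open>i\<close>. Which end of an edge is called \<open>a i\<close> is free. If this is decided
  by fair coins, then half of the at least \<open>c n\<close> neighbours of \<open>a i\<close> are expected among the \<open>b j\<close>, and
  the probability of falling below \<open>c n / (2 + \<epsilon>)\<close> is exponentially small. A union bound over all
  vertices leaves a good orientation (\<open>good_choice_exists\<close>). This is where the 2 in the statement comes from.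

  For the existence (\<open>rainbow_perfect_matching\<close>) the minimum degree \<open>n\<close> is exactly at the threshold, and the
  argument is an exchange argument without any loss. Starting from a rainbow matching that misses one colour, double
  counting produces a vertex \<open>w\<close> that many matched vertices could be rematched to without changing the colour of
  their edge. Freeing \<open>w\<close> by deleting its edge leaves four vertices and two colours, and as \<open>w\<close> is so
  easily absorbed, it suffices to place the other three vertices; \<open>popular_spare_vertex\<close> does this by
  involving one further matching edge.
\<close>

section \<open>Rainbow matchings\<close>

definition nbrs :: "('c \<Rightarrow> 'v set set) \<Rightarrow> 'c \<Rightarrow> 'v \<Rightarrow> 'v set" where
  "nbrs E c v = {u. {v, u} \<in> E c}"

text \<open>A matching on \<open>S\<close> that uses each colour of \<open>C\<close> exactly once is stored by its two ends in each colour: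
  the edge of colour \<open>i\<close> is \<open>{m i True, m i False}\<close>. The Boolean tag makes the partner of the vertex
  \<open>m i b\<close> available as \<open>m i (\<not> b)\<close>, and it later serves as the orientation of the edges.\<close>

definition rainbow_by :: "('c \<Rightarrow> 'v set set) \<Rightarrow> ('c \<Rightarrow> bool \<Rightarrow> 'v) \<Rightarrow> 'v set \<Rightarrow> 'c set \<Rightarrow> bool" where
  "rainbow_by E m S C \<longleftrightarrow>
     bij_betw (\<lambda>(i, b). m i b) (C \<times> UNIV) S \<and> (\<forall>i\<in>C. \<forall>b. {m i b, m i (\<not> b)} \<in> E i)"

definition rainbow :: "('c \<Rightarrow> 'v set set) \<Rightarrow> 'v set \<Rightarrow> 'c set \<Rightarrow> bool" where
  "rainbow E S C \<longleftrightarrow> (\<exists>m. rainbow_by E m S C)"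

text \<open>The matched vertices that could be rematched to \<open>w\<close> while keeping the colour of their own
  matching edge. Rematching one of them frees its partner.\<close>

definition in_darts :: "('c \<Rightarrow> 'v set set) \<Rightarrow> ('c \<Rightarrow> bool \<Rightarrow> 'v) \<Rightarrow> 'c set \<Rightarrow> 'v \<Rightarrow> ('c \<times> bool) set" where
  "in_darts E m C w = {(i, b) \<in> C \<times> UNIV. {m i b, w} \<in> E i}"

lemma finite_in_darts: "finite C \<Longrightarrow> finite (in_darts E m C w)"
  by (rule finite_subset[of _ "C \<times> UNIV"]) (auto simp: in_darts_def)

lemma rainbow_empty: "rainbow E {} {}"
  by (auto simp: rainbow_def rainbow_by_def bij_betw_def)

lemma rainbow_edge:
  assumes "{u, v} \<in> E c" "u \<noteq> v"
  shows "rainbow E {u, v} {c}"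
proof -
  have "rainbow_by E (\<lambda>_ b. if b then u else v) {u, v} {c}"
    using assms by (auto simp: rainbow_by_def bij_betw_def inj_on_def insert_commute image_iff split: if_splits)
  then show ?thesis by (auto simp: rainbow_def)
qed

lemma rainbow_Un:
  assumes "rainbow E S C" "rainbow E S' C'" "S \<inter> S' = {}" "C \<inter> C' = {}"
  shows "rainbow E (S \<union> S') (C \<union> C')"
proof -
  obtain m m' where m: "rainbow_by E m S C" and m': "rainbow_by E m' S' C'"
    using assms by (auto simp: rainbow_def)
  define g where "g = (\<lambda>i. if i \<in> C then m i else m' i)"
  have 1: "bij_betw (\<lambda>(i, b). g i b) (C \<times> UNIV) S"
    using m by (subst bij_betw_cong[where g = "\<lambda>(i, b). m i b"]) (auto simp: rainbow_by_def g_def)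
  have 2: "bij_betw (\<lambda>(i, b). g i b) (C' \<times> UNIV) S'"
    using m' assms(4)
    by (subst bij_betw_cong[where g = "\<lambda>(i, b). m' i b"]) (auto simp: rainbow_by_def g_def)
  have "bij_betw (\<lambda>(i, b). g i b) ((C \<union> C') \<times> UNIV) (S \<union> S')"
    using bij_betw_combine[OF 1 2 assms(3)] by (simp add: Sigma_Un_distrib1)
  then have "rainbow_by E g (S \<union> S') (C \<union> C')"
    using m m' by (auto simp: rainbow_by_def g_def)
  then show ?thesis by (auto simp: rainbow_def)
qed

lemma rainbow_card:
  assumes "rainbow E S C" shows "card S = 2 * card C"
proof -
  obtain m where "bij_betw (\<lambda>(i, b). m i b) (C \<times> (UNIV :: bool set)) S"
    using assms unfolding rainbow_def rainbow_by_def by blast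
  from bij_betw_same_card[OF this] show ?thesis by (simp add: card_cartesian_product)
qed

lemma rainbow_by_mem: "rainbow_by E m S C \<Longrightarrow> i \<in> C \<Longrightarrow> m i b \<in> S"
  by (auto simp: rainbow_by_def bij_betw_def)

lemma rainbow_by_eq_iff:
  "rainbow_by E m S C \<Longrightarrow> i \<in> C \<Longrightarrow> j \<in> C \<Longrightarrow> m i b = m j b' \<longleftrightarrow> i = j \<and> b = b'"
  by (auto simp: rainbow_by_def bij_betw_def inj_on_def)

lemma rainbow_by_surj:
  assumes "rainbow_by E m S C" "v \<in> S"
  obtains i b where "i \<in> C" "v = m i b"
  using assms by (auto simp: rainbow_by_def bij_betw_def)

lemma rainbow_by_edge: "rainbow_by E m S C \<Longrightarrow> i \<in> C \<Longrightarrow> {m i b, m i (\<not> b)} \<in> E i"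
  by (auto simp: rainbow_by_def)

lemma rainbow_by_remove:
  assumes "rainbow_by E m S C" "i \<in> C"
  shows "rainbow_by E m (S - {m i b, m i (\<not> b)}) (C - {i})"
proof -
  have "bij_betw (\<lambda>(i, b). m i b) (C \<times> UNIV - {(i, b), (i, \<not> b)}) (S - {m i b, m i (\<not> b)})"
    using assms
    by (auto simp: rainbow_by_def bij_betw_def inj_on_def image_iff)
  moreover have "C \<times> UNIV - {(i, b), (i, \<not> b)} = (C - {i}) \<times> (UNIV :: bool set)"
    by (cases b) (auto simp: UNIV_bool)
  ultimately show ?thesis using assms by (auto simp: rainbow_by_def)
qed

text \<open>The counting step behind every exchange below: \<open>A\<close> and the set of partners of \<open>B\<close> are too large
  together to be disjoint sets of ends of matching edges.\<close>

lemma partner_pigeonhole: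
  fixes C :: "'c set"
  assumes "finite C" "A \<subseteq> C \<times> (UNIV :: bool set)" "B \<subseteq> C \<times> UNIV" "2 * card C < card A + card B"
  obtains i b where "i \<in> C" "(i, b) \<in> A" "(i, \<not> b) \<in> B"
proof -
  let ?f = "\<lambda>(i :: 'c, b). (i, \<not> b)"
  have inj: "inj ?f" by (auto simp: inj_on_def)
  have sub: "A \<union> ?f ` B \<subseteq> C \<times> UNIV" using assms by auto
  have fin: "finite A" "finite (?f ` B)"
    using sub \<open>finite C\<close> by (meson finite_SigmaI finite_UNIV finite_subset le_sup_iff)+
  have "A \<inter> ?f ` B \<noteq> {}"
  proof
    assume "A \<inter> ?f ` B = {}"
    then have "card A + card B = card (A \<union> ?f ` B)"
      using fin card_image[OF inj_on_subset[OF inj subset_UNIV]] by (simp add: card_Un_disjoint)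
    also have "\<dots> \<le> card (C \<times> (UNIV :: bool set))"
      using sub \<open>finite C\<close> by (intro card_mono) auto
    finally show False using assms(4) by (simp add: card_cartesian_product)
  qed
  then show ?thesis using that assms(3) by fastforce
qed

lemma rainbow_by_card_vertices:
  assumes "rainbow_by E m S C"
  shows "card {(i, b) \<in> C \<times> UNIV. m i b \<in> X} = card (X \<inter> S)"
proof (rule bij_betw_same_card)
  show "bij_betw (\<lambda>(i, b). m i b) {(i, b) \<in> C \<times> UNIV. m i b \<in> X} (X \<inter> S)"
    using assms by (auto simp: rainbow_by_def bij_betw_def inj_on_def image_iff)
qed

section \<open>Rainbow perfect matchings under the Dirac condition\<close>

locale dirac_family =
  fixes E :: "'c \<Rightarrow> 'v set set" and V :: "'v set" and C :: "'c set"
  assumes finite_V: "finite V" and finite_C: "finite C" and card_V: "card V = 2 * card C"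
    and edge: "c \<in> C \<Longrightarrow> e \<in> E c \<Longrightarrow> e \<subseteq> V \<and> card e = 2"
    and nbrs_ge: "c \<in> C \<Longrightarrow> v \<in> V \<Longrightarrow> card C \<le> card (nbrs E c v)"
begin

lemma nbrs_subset: "c \<in> C \<Longrightarrow> nbrs E c v \<subseteq> V - {v}"
  using edge by (fastforce simp: nbrs_def)

lemma rainbow_nbr: "c \<in> C \<Longrightarrow> u \<in> nbrs E c v \<Longrightarrow> rainbow E {v, u} {c}"
  using nbrs_subset[of c v] by (auto simp: nbrs_def intro!: rainbow_edge)

text \<open>Suppose everything is matched except \<open>r\<close> and \<open>w\<close>, and \<open>s\<close> is the unused colour. If some matching edge has
  one end in \<open>in_darts\<close> of \<open>w\<close> and the other end joined to \<open>r\<close> in colour \<open>s\<close>, then replacing it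
  by these two edges completes the matching. The part \<open>R\<close> of the matching is left alone; the
  hypothesis \<open>many\<close> says that the remaining part is rich enough for the pigeonhole principle.\<close>

lemma close_up:
  assumes m: "rainbow_by E m S C0" and RB: "rainbow E R B"
    and V: "V = R \<union> S \<union> {r, w}" and C: "C = B \<union> C0 \<union> {s}"
    and disj: "R \<inter> S = {}" "B \<inter> C0 = {}" "r \<notin> R \<union> S" "w \<notin> R \<union> S" "r \<noteq> w" "s \<notin> B \<union> C0"
    and many: "2 * card C0 + card (nbrs E s r \<inter> R) < card (in_darts E m C0 w) + card C"
  shows "rainbow E V C"
proof (cases "w \<in> nbrs E s r")
  case True
  then have 1: "rainbow E {r, w} {s}" using C by (intro rainbow_nbr) auto
  have "rainbow E (R \<union> S) (B \<union> C0)"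
    using m RB disj by (intro rainbow_Un) (auto simp: rainbow_def)
  from rainbow_Un[OF this 1] show ?thesis using disj V C by auto
next
  case False
  have C0: "finite C0" using C finite_C by auto
  have fR: "finite R" "finite S" using V finite_V by auto
  let ?N = "nbrs E s r"
  have "?N \<subseteq> R \<union> S" using False nbrs_subset[of s r] V C by auto
  then have "card ?N \<le> card ((?N \<inter> R) \<union> (?N \<inter> S))" using fR by (intro card_mono) auto
  also have "\<dots> \<le> card (?N \<inter> R) + card (?N \<inter> S)" by (rule card_Un_le)
  finally have "card C \<le> card (?N \<inter> R) + card (?N \<inter> S)"
    using nbrs_ge[of s r] V C by auto
  then have *: "2 * card C0 < card (in_darts E m C0 w) + card {(i, b) \<in> C0 \<times> UNIV. m i b \<in> ?N}"
    using many rainbow_by_card_vertices[OF m, of ?N] by simp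
  obtain i b where i: "i \<in> C0" "(i, b) \<in> in_darts E m C0 w" "m i (\<not> b) \<in> ?N"
    using partner_pigeonhole[OF C0 _ _ *] by (auto simp: in_darts_def)
  have "{m i b, w} \<in> E i" using i by (auto simp: in_darts_def)
  then have 1: "rainbow E {m i b, w} {i}"
    using i C by (intro rainbow_nbr) (auto simp: nbrs_def)
  have 2: "rainbow E {r, m i (\<not> b)} {s}" using i C by (intro rainbow_nbr) auto
  have 3: "rainbow E (S - {m i b, m i (\<not> b)}) (C0 - {i})"
    using rainbow_by_remove[OF m i(1)] by (auto simp: rainbow_def)
  have mem: "m i b \<in> S" "m i (\<not> b) \<in> S" "m i b \<noteq> m i (\<not> b)"
    using rainbow_by_mem[OF m i(1)] rainbow_by_eq_iff[OF m i(1) i(1)] by auto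
  have 12: "rainbow E ({m i b, w} \<union> {r, m i (\<not> b)}) ({i} \<union> {s})"
    using mem disj i(1) by (intro rainbow_Un[OF 1 2]) auto
  have 3: "rainbow E (R \<union> (S - {m i b, m i (\<not> b)})) (B \<union> (C0 - {i}))"
    using disj by (intro rainbow_Un[OF RB 3]) auto
  have "rainbow E ({m i b, w} \<union> {r, m i (\<not> b)} \<union> (R \<union> (S - {m i b, m i (\<not> b)})))
          ({i} \<union> {s} \<union> (B \<union> (C0 - {i})))"
    using mem disj i(1) by (intro rainbow_Un[OF 12 3]) auto
  moreover have "{m i b, w} \<union> {r, m i (\<not> b)} \<union> (R \<union> (S - {m i b, m i (\<not> b)})) = V"
    using mem V by auto
  moreover have "{i} \<union> {s} \<union> (B \<union> (C0 - {i})) = C" using i C by auto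
  ultimately show ?thesis by simp
qed

lemma card_in_darts_remove:
  assumes "finite C0"
  shows "card (in_darts E m C0 w) \<le> card (in_darts E m (C0 - {j}) w) + 2"
proof -
  have "d \<in> in_darts E m (C0 - {j}) w \<union> {(j, True), (j, False)}" if "d \<in> in_darts E m C0 w" for d
    using that by (cases d; cases "snd d"; cases "fst d = j") (simp_all add: in_darts_def)
  then have "in_darts E m C0 w \<subseteq> in_darts E m (C0 - {j}) w \<union> {(j, True), (j, False)}"
    by blast
  moreover have "finite (in_darts E m (C0 - {j}) w)"
    using assms by (intro finite_in_darts) simp
  ultimately have "card (in_darts E m C0 w)
      \<le> card (in_darts E m (C0 - {j}) w \<union> {(j, True), (j, False)})"
    by (intro card_mono) auto
  also have "\<dots> \<le> card (in_darts E m (C0 - {j}) w) + card {(j, True), (j, False)}"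
    by (rule card_Un_le)
  finally show ?thesis by simp
qed

text \<open>The heart of the existence proof. Two colours \<open>p\<close>, \<open>q\<close> and four vertices are spare, and one of these,
  \<open>w\<close>, is popular: more than half of all matched vertices can be rematched to \<open>w\<close>. Any arrangement
  that leaves just \<open>w\<close> and one other vertex unmatched can then be completed by \<open>close_up\<close>, unless
  that other vertex wastes too many of its neighbours on the few vertices that were rearranged by hand.
  So if no perfect matching exists, then \<open>x\<close>, \<open>y\<close>, \<open>v\<close> are pairwise nonadjacent in both spare colours.
  Hence \<open>x\<close> in colour \<open>p\<close> and \<open>y\<close> in colour \<open>q\<close> can be joined to the two ends \<open>u\<close>, \<open>u'\<close> of one
  matching edge, whose colour \<open>j\<close> becomes spare. Now \<open>v\<close> must be adjacent in colour \<open>j\<close> to \<open>u\<close> or \<open>u'\<close>,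
  for otherwise it wastes at most \<open>x\<close> and \<open>y\<close>; giving that end to \<open>v\<close> leaves \<open>x\<close> or \<open>y\<close> as the last
  vertex, and that vertex wastes at most the two neighbours \<open>u\<close>, \<open>u'\<close>.\<close>

lemma popular_spare_vertex:
  assumes m: "rainbow_by E m S C0"
    and V: "V = S \<union> {x, y, v, w}" and C: "C = C0 \<union> {p, q}"
    and disj: "x \<notin> S" "y \<notin> S" "v \<notin> S" "w \<notin> S" "distinct [x, y, v, w]" "p \<notin> C0" "q \<notin> C0" "p \<noteq> q"
    and popular: "card C \<le> card (in_darts E m C0 w) + 1"
  shows "rainbow E V C"
proof (rule ccontr)
  assume no: "\<not> rainbow E V C"
  have fC0: "finite C0" using C finite_C by auto
  have cC: "card C = card C0 + 2" using C disj fC0 by simp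
  have two: "card (X \<inter> {a, b}) \<le> 2" for X and a b :: 'v
    by (rule le_trans[OF card_mono[of "{a, b}"]]) (auto simp: card_insert_if)
  have nonadj: "r' \<notin> nbrs E s r"
    if "{r, r', r''} = {x, y, v}" "card {r, r', r''} = 3" "{s, t} = {p, q}" for r r' r'' s t
  proof
    assume *: "r' \<in> nbrs E s r"
    have d: "r \<noteq> r'" "r \<noteq> r''" "r' \<noteq> r''" using that(2) by (auto simp: card_insert_if split: if_splits)
    have st: "s \<noteq> t" "s \<in> C" "t \<notin> C0" "s \<notin> C0" using that(3) disj C by (auto simp: doubleton_eq_iff)
    have V': "V = {r, r'} \<union> S \<union> {r'', w}" using that(1) V by auto
    have C': "C = {s} \<union> C0 \<union> {t}" using that(3) C by auto
    have dd: "r \<notin> S" "r' \<notin> S" "r'' \<notin> S" "r \<noteq> w" "r' \<noteq> w" "r'' \<noteq> w"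
      using disj that(1) by auto
    have "rainbow E V C"
      by (rule close_up[OF m rainbow_nbr[OF st(2) *] V' C'])
        (use d dd st disj popular cC two[of "nbrs E t r''" r r'] in auto)
    then show False using no by simp
  qed
  have xyv: "nbrs E s r \<inter> {x, y, v} = {}" if r: "r \<in> {x, y, v}" and s: "s \<in> {p, q}" for r s
  proof -
    have c3: "card {x, y, v} = 3" using disj by simp
    obtain t where t: "{s, t} = {p, q}" using s by auto
    have perm: "{x, v, y} = {x, y, v}" "{y, x, v} = {x, y, v}" "{y, v, x} = {x, y, v}"
      "{v, x, y} = {x, y, v}" "{v, y, x} = {x, y, v}" by auto
    have "r \<notin> nbrs E s r" using nbrs_subset[of s r] s C by auto
    then show ?thesis
      using r nonadj[OF _ _ t, of x y v] nonadj[OF _ _ t, of x v y] nonadj[OF _ _ t, of y x v]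
        nonadj[OF _ _ t, of y v x] nonadj[OF _ _ t, of v x y] nonadj[OF _ _ t, of v y x] c3 perm
      by auto
  qed
  have many: "card C0 + 1 \<le> card {(i, b) \<in> C0 \<times> UNIV. m i b \<in> nbrs E s r}"
    if "r \<in> {x, y, v}" "s \<in> {p, q}" for r s
  proof -
    have "nbrs E s r \<subseteq> (nbrs E s r \<inter> S) \<union> {w}"
      using xyv[OF that] nbrs_subset[of s r] V C that by auto
    then have "card (nbrs E s r) \<le> card (insert w (nbrs E s r \<inter> S))"
      using finite_V V by (intro card_mono) auto
    also have "\<dots> \<le> Suc (card (nbrs E s r \<inter> S))" by (simp add: card_insert_le_m1 card_insert_if finite_V V)
    finally show ?thesis
      using nbrs_ge[of s r] that V C cC rainbow_by_card_vertices[OF m, of "nbrs E s r"] by auto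
  qed
  have "2 * card C0 < card {(i, b) \<in> C0 \<times> UNIV. m i b \<in> nbrs E p x}
          + card {(i, b) \<in> C0 \<times> UNIV. m i b \<in> nbrs E q y}"
    using many[of x p] many[of y q] by simp
  then obtain j b where j: "j \<in> C0" "m j b \<in> nbrs E p x" "m j (\<not> b) \<in> nbrs E q y"
    using partner_pigeonhole[OF fC0, of "{(i, b) \<in> C0 \<times> UNIV. m i b \<in> nbrs E p x}"
        "{(i, b) \<in> C0 \<times> UNIV. m i b \<in> nbrs E q y}"] by auto
  define u u' where "u = m j b" and "u' = m j (\<not> b)"
  have u: "u \<in> S" "u' \<in> S" "u \<noteq> u'"
    using rainbow_by_mem[OF m j(1)] rainbow_by_eq_iff[OF m j(1) j(1)] by (auto simp: u_def u'_def)
  note m1 = rainbow_by_remove[OF m j(1), of b, folded u_def u'_def]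
  have pop1: "card C0 \<le> card (in_darts E m (C0 - {j}) w) + 1"
    using card_in_darts_remove[OF fC0, of m w j] popular cC by simp
  have cC1: "card C0 = Suc (card (C0 - {j}))" using j(1) fC0 by (metis card_Suc_Diff1)
  \<comment> \<open>Among \<open>x\<close>, \<open>y\<close>, \<open>v\<close>, \<open>u\<close>, \<open>u'\<close>, two edges are placed by hand and \<open>r\<close> is left over for colour \<open>k\<close>.
    Removing colour \<open>j\<close> costs at most two darts into \<open>w\<close>, which is affordable when \<open>r\<close> has at most two
    neighbours among the other four.\<close>
  have close: False
    if "e \<in> nbrs E s d" "g \<in> nbrs E t f" "{d, e, f, g, r} = {x, y, v, u, u'}"
      "distinct [d, e, f, g, r]" "{s, t, k} = {p, q, j}" "distinct [s, t, k]"
      "nbrs E k r \<inter> {d, e, f, g} \<subseteq> {a, a'}" for d e f g r s t k a a'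
  proof -
    note ds = that(4) and dc = that(6)
    have stC: "s \<in> C" "t \<in> C" using that(5) C j(1) by auto
    have R: "rainbow E ({d, e} \<union> {f, g}) ({s} \<union> {t})"
      using ds dc by (intro rainbow_Un rainbow_nbr stC that) auto
    have V': "V = {d, e} \<union> {f, g} \<union> (S - {u, u'}) \<union> {r, w}"
    proof -
      have "V = {x, y, v, u, u'} \<union> (S - {u, u'}) \<union> {w}" using V u by auto
      then show ?thesis unfolding that(3)[symmetric] by auto
    qed
    have C': "C = {s} \<union> {t} \<union> (C0 - {j}) \<union> {k}"
    proof -
      have "C = {p, q, j} \<union> (C0 - {j})" using C j by auto
      then show ?thesis unfolding that(5)[symmetric] by auto
    qed
    have x5: "z \<notin> S - {u, u'} \<and> z \<noteq> w" if "z \<in> {d, e, f, g, r}" for z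
      using that u disj unfolding \<open>{d, e, f, g, r} = {x, y, v, u, u'}\<close> by auto
    have c3: "z \<notin> C0 - {j}" if "z \<in> {s, t, k}" for z
      using that disj unfolding \<open>{s, t, k} = {p, q, j}\<close> by auto
    have "card (nbrs E k r \<inter> ({d, e} \<union> {f, g})) \<le> card {a, a'}"
      using that(7) by (intro card_mono) auto
    also have "\<dots> \<le> 2" by (simp add: card_insert_if)
    finally have c2: "card (nbrs E k r \<inter> ({d, e} \<union> {f, g})) \<le> 2" .
    have "rainbow E V C"
      by (rule close_up[OF m1 R V' C'])
        (use x5[of d] x5[of e] x5[of f] x5[of g] x5[of r] disj ds dc c3[of s] c3[of t] c3[of k]
          pop1 cC cC1 c2 in auto)
    then show False using no by simp
  qed
  have ne: "z \<noteq> u \<and> z \<noteq> u' \<and> u \<noteq> z \<and> u' \<noteq> z" if "z \<in> {x, y, v}" for z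
    using that disj(1-3) u by auto
  have jne: "j \<noteq> p" "j \<noteq> q" "p \<noteq> j" "q \<noteq> j" using disj j by auto
  have xu: "u \<in> nbrs E p x" and yu: "u' \<in> nbrs E q y" using j by (auto simp: u_def u'_def)
  have "u \<in> nbrs E j v \<or> u' \<in> nbrs E j v"
  proof (rule ccontr)
    assume "\<not> ?thesis"
    then have sub: "nbrs E j v \<inter> {x, u, y, u'} \<subseteq> {x, y}" by auto
    show False
      by (rule close[OF xu yu _ _ _ _ sub]) (use ne disj(5,8) jne u(3) in auto)
  qed
  then show False
  proof
    assume vu: "u \<in> nbrs E j v"
    have sub: "nbrs E p x \<inter> {v, u, y, u'} \<subseteq> {u, u'}" using xyv[of x p] by auto
    show False
      by (rule close[OF vu yu _ _ _ _ sub]) (use ne disj(5,8) jne u(3) in auto)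
  next
    assume vu: "u' \<in> nbrs E j v"
    have sub: "nbrs E q y \<inter> {v, u', x, u} \<subseteq> {u, u'}" using xyv[of y q] by auto
    show False
      by (rule close[OF vu xu _ _ _ _ sub]) (use ne disj(5,8) jne u(3) in auto)
  qed
qed

text \<open>Take a rainbow matching with as many colours as possible. If two colours were spare, then two spare
  vertices would have all their neighbours in these colours among the matched vertices, hence at two ends of
  a common matching edge; exchanging that edge for the two new ones enlarges the matching.\<close>

lemma rainbow_missing_one:
  assumes no: "\<not> rainbow E V C"
  obtains p x y where "p \<in> C" "x \<in> V" "y \<in> V" "x \<noteq> y" "rainbow E (V - {x, y}) (C - {p})"
proof -
  let ?P = "\<lambda>(S, D). rainbow E S D \<and> S \<subseteq> V \<and> D \<subseteq> C"
  have "card D \<le> card C" if "D \<subseteq> C" for D using that finite_C card_mono by blast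
  then have "\<forall>X. ?P X \<longrightarrow> card (snd X) < Suc (card C)" by (auto simp: less_Suc_eq_le)
  moreover have "?P ({}, {})" by (simp add: rainbow_empty)
  ultimately obtain S D where P: "?P (S, D)"
    and max: "\<And>S' D'. ?P (S', D') \<Longrightarrow> card D' \<le> card D"
    using ex_has_greatest_nat[of ?P "({}, {})" "\<lambda>X. card (snd X)" "Suc (card C)"] by force
  then have SD: "rainbow E S D" "S \<subseteq> V" "D \<subseteq> C" by auto
  have fin: "finite S" "finite D" using SD finite_V finite_C finite_subset by blast+
  have cS: "card S = 2 * card D" using rainbow_card[OF SD(1)] .
  have "D \<noteq> C"
  proof
    assume "D = C"
    then have "S = V" using card_subset_eq[OF finite_V SD(2)] cS card_V by simp
    then show False using no SD \<open>D = C\<close> by simp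
  qed
  then obtain p where p: "p \<in> C" "p \<notin> D" using SD by auto
  have maximal: "nbrs E c z \<subseteq> S" if "c \<in> C - D" "z \<in> V - S" for c z
  proof
    fix u assume u: "u \<in> nbrs E c z"
    show "u \<in> S"
    proof (rule ccontr)
      assume "u \<notin> S"
      then have "rainbow E (S \<union> {z, u}) (D \<union> {c})"
        using that u by (intro rainbow_Un SD rainbow_nbr) auto
      moreover have "u \<in> V" using nbrs_subset[of c z] u that by auto
      ultimately have "card (D \<union> {c}) \<le> card D" using that SD by (intro max[of "S \<union> {z, u}"]) auto
      then show False using that fin by simp
    qed
  qed
  have DC: "D = C - {p}"
  proof (rule ccontr)
    assume "D \<noteq> C - {p}"
    then obtain q where q: "q \<in> C" "q \<notin> D" "q \<noteq> p" using SD p by auto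
    have "card (D \<union> {p, q}) \<le> card C" using p q SD finite_C by (intro card_mono) auto
    then have cD: "card D + 2 \<le> card C" using p q fin by simp
    have "card (V - S) = card V - card S" using card_Diff_subset fin SD by blast
    then have "2 \<le> card (V - S)" using cD card_V cS by simp
    then obtain x y where xy: "x \<in> V - S" "y \<in> V - S" "x \<noteq> y"
      by (meson card_2_iff' obtain_subset_with_card_n subset_iff)
    obtain m where m: "rainbow_by E m S D" using SD by (auto simp: rainbow_def)
    let ?A = "\<lambda>c z. {(i, b) \<in> D \<times> UNIV. m i b \<in> nbrs E c z}"
    have "card C \<le> card (?A c z)" if "c \<in> C - D" "z \<in> V - S" for c z
      using maximal[OF that] nbrs_ge[of c z] that rainbow_by_card_vertices[OF m, of "nbrs E c z"]
      by (simp add: Int_absorb2)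
    from this[of p x] this[of q y] have "2 * card D < card (?A p x) + card (?A q y)"
      using p q xy cD by simp
    then obtain j b where j: "j \<in> D" "m j b \<in> nbrs E p x" "m j (\<not> b) \<in> nbrs E q y"
      using partner_pigeonhole[OF fin(2), of "?A p x" "?A q y"] by auto
    let ?u = "m j b" and ?u' = "m j (\<not> b)"
    have u: "?u \<in> S" "?u' \<in> S" "?u \<noteq> ?u'"
      using rainbow_by_mem[OF m j(1)] rainbow_by_eq_iff[OF m j(1) j(1)] by auto
    have "rainbow E (S - {?u, ?u'}) (D - {j})"
      using rainbow_by_remove[OF m j(1)] by (auto simp: rainbow_def)
    moreover have "rainbow E ({x, ?u} \<union> {y, ?u'}) ({p} \<union> {q})"
      using u xy q
      by (intro rainbow_Un[OF rainbow_nbr[OF p(1) j(2)] rainbow_nbr[OF q(1) j(3)]]) auto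
    ultimately have "rainbow E ((S - {?u, ?u'}) \<union> ({x, ?u} \<union> {y, ?u'})) ((D - {j}) \<union> ({p} \<union> {q}))"
      by (rule rainbow_Un) (use xy p q u in auto)
    then have "card ((D - {j}) \<union> ({p} \<union> {q})) \<le> card D"
      using SD xy p q u j by (intro max[of "(S - {?u, ?u'}) \<union> ({x, ?u} \<union> {y, ?u'})"]) auto
    moreover have "card ((D - {j}) \<union> ({p} \<union> {q})) = card D + 1"
    proof -
      have "0 < card D" using j fin card_gt_0_iff by blast
      then show ?thesis using p q j fin by simp
    qed
    ultimately show False by simp
  qed
  have "card C = Suc (card D)" using DC p finite_C by (metis card_Suc_Diff1)
  then have "card (V - S) = 2" using card_V cS card_Diff_subset[of S V] fin SD by simp
  then obtain x y where "V - S = {x, y}" "x \<noteq> y" by (auto simp: card_2_iff)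
  then have "S = V - {x, y}" "x \<in> V" "y \<in> V" using SD by auto
  then show ?thesis using that[OF p(1)] SD DC \<open>x \<noteq> y\<close> by simp
qed

lemma sum_in_darts:
  assumes "finite D" "D \<subseteq> C"
  shows "(\<Sum>w\<in>V. card (in_darts E m D w)) = (\<Sum>(i, b)\<in>D \<times> UNIV. card (nbrs E i (m i b)))"
proof -
  let ?R = "\<lambda>w d. d \<in> in_darts E m D w"
  have "{w \<in> V. ?R w (i, b)} = nbrs E i (m i b)" if "i \<in> D" for i b
    using that assms(2) nbrs_subset[of i "m i b"] by (auto simp: in_darts_def nbrs_def)
  then have "\<forall>d\<in>D \<times> UNIV. card {w \<in> V. ?R w d} = (case d of (i, b) \<Rightarrow> card (nbrs E i (m i b)))"
    by auto
  from sum_multicount_gen[OF finite_V _ this] assms(1)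
  have "(\<Sum>w\<in>V. card {d \<in> D \<times> UNIV. ?R w d}) = (\<Sum>(i, b)\<in>D \<times> UNIV. card (nbrs E i (m i b)))"
    by simp
  moreover have "{d \<in> D \<times> UNIV. ?R w d} = in_darts E m D w" for w
    by (auto simp: in_darts_def)
  ultimately show ?thesis by simp
qed

text \<open>The rainbow version of Dirac's condition for perfect matchings, due to Joos and Kim. Start from a matching
  that misses one colour \<open>p\<close> and two vertices \<open>x\<close>, \<open>y\<close>. On average at least \<open>card C - 1\<close> darts lead
  into a vertex, but fewer lead into \<open>x\<close> and \<open>y\<close>, since otherwise \<open>close_up\<close> applies. This deficit
  pushes the average over the matched vertices above \<open>card C - 1\<close>, so some matched vertex \<open>w\<close> has at
  least \<open>card C\<close> darts. Deleting the edge at \<open>w\<close> makes \<open>w\<close> a popular spare vertex.\<close>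

proposition rainbow_perfect_matching: "rainbow E V C"
proof (rule ccontr)
  assume no: "\<not> rainbow E V C"
  obtain p x y where p: "p \<in> C" and xy: "x \<in> V" "y \<in> V" "x \<noteq> y"
    and "rainbow E (V - {x, y}) (C - {p})"
    using rainbow_missing_one[OF no] .
  define S D where "S = V - {x, y}" and "D = C - {p}"
  obtain m where m: "rainbow_by E m S D"
    using \<open>rainbow E (V - {x, y}) (C - {p})\<close> by (auto simp: rainbow_def S_def D_def)
  have fD: "finite D" and cD: "card C = Suc (card D)"
    using p finite_C card_Suc_Diff1[of C p] by (auto simp: D_def)
  have V: "V = {} \<union> S \<union> {x, y}" "V = {} \<union> S \<union> {y, x}" and C: "C = {} \<union> D \<union> {p}"
    using xy p by (auto simp: S_def D_def)
  have xyS: "x \<notin> {} \<union> S" "y \<notin> {} \<union> S" "y \<noteq> x" "p \<notin> {} \<union> D"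
    using xy by (auto simp: S_def D_def)
  have sxy: "card (in_darts E m D x) + 1 \<le> card D" "card (in_darts E m D y) + 1 \<le> card D"
    using close_up[OF m rainbow_empty V(2) C _ _ xyS(2,1,3,4)]
      close_up[OF m rainbow_empty V(1) C _ _ xyS(1,2) xy(3) xyS(4)] no cD by fastforce+
  have "\<exists>w\<in>S. card C \<le> card (in_darts E m D w)"
  proof (rule ccontr)
    assume "\<not> ?thesis"
    then have small: "card (in_darts E m D w) \<le> card D" if "w \<in> S" for w
      using that cD by fastforce
    have fS: "finite S" using finite_V by (simp add: S_def)
    have "2 * card D * card C = (\<Sum>d\<in>D \<times> (UNIV :: bool set). card C)"
      by (simp add: card_cartesian_product)
    also have "\<dots> \<le> (\<Sum>(i, b)\<in>D \<times> UNIV. card (nbrs E i (m i b)))"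
      using rainbow_by_mem[OF m] by (intro sum_mono) (auto intro!: nbrs_ge simp: D_def S_def)
    also have "\<dots> = (\<Sum>w\<in>V. card (in_darts E m D w))"
      using fD by (intro sum_in_darts[symmetric]) (auto simp: D_def)
    also have "\<dots> = (\<Sum>w\<in>S. card (in_darts E m D w)) + card (in_darts E m D x) + card (in_darts E m D y)"
    proof -
      have "V = insert x (insert y S)" "x \<notin> insert y S" "y \<notin> S" using xy by (auto simp: S_def)
      then show ?thesis using fS by simp
    qed
    also have "(\<Sum>w\<in>S. card (in_darts E m D w)) \<le> (\<Sum>w\<in>S. card D)"
      using small by (rule sum_mono)
    also have "\<dots> = 2 * card D * card D"
      using rainbow_card[of E S D] m by (auto simp: rainbow_def)
    finally show False using sxy cD by simp
  qed
  then obtain w where w: "w \<in> S" "card C \<le> card (in_darts E m D w)" by blast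
  then obtain q b where q: "q \<in> D" "w = m q b"
    using rainbow_by_surj[OF m] by blast
  define v where "v = m q (\<not> b)"
  have v: "v \<in> S" "v \<noteq> w" using rainbow_by_mem[OF m q(1)] rainbow_by_eq_iff[OF m q(1) q(1)] q
    by (auto simp: v_def)
  have m0: "rainbow_by E m (S - {w, v}) (D - {q})"
    using rainbow_by_remove[OF m q(1), of b] by (simp add: q v_def)
  \<comment> \<open>Only one dart is lost with the edge at \<open>w\<close>, because \<open>w\<close> is not its own neighbour.\<close>
  have "in_darts E m D w \<subseteq> insert (q, \<not> b) (in_darts E m (D - {q}) w)"
  proof
    fix d assume d: "d \<in> in_darts E m D w"
    have "{w, w} \<notin> E q" using edge[of q "{w, w}"] q by (auto simp: D_def)
    moreover obtain i c where ic: "d = (i, c)" by fastforce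
    moreover have "i \<in> D" "{m i c, w} \<in> E i" using d by (simp_all add: in_darts_def ic)
    ultimately have "i = q \<longrightarrow> c = (\<not> b)" using q(2) by (cases c; cases b) auto
    then show "d \<in> insert (q, \<not> b) (in_darts E m (D - {q}) w)"
      using \<open>i \<in> D\<close> \<open>{m i c, w} \<in> E i\<close> by (cases "i = q") (simp_all add: in_darts_def ic)
  qed
  then have "card (in_darts E m D w) \<le> card (insert (q, \<not> b) (in_darts E m (D - {q}) w))"
    using fD by (intro card_mono) (auto intro: finite_in_darts)
  also have "\<dots> \<le> Suc (card (in_darts E m (D - {q}) w))"
    using fD by (simp add: card_insert_if finite_in_darts)
  finally have popular: "card C \<le> card (in_darts E m (D - {q}) w) + 1" using w by simp
  have "rainbow E V C"
    by (rule popular_spare_vertex[OF m0 _ _ _ _ _ _ _ _ _ _ popular, of x y v p q])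
      (use v w q xy p in \<open>auto simp: S_def D_def\<close>)
  then show False using no by simp
qed

end

section \<open>Counting systems of distinct representatives\<close>

definition systems_of_reps :: "'a set \<Rightarrow> 'b set \<Rightarrow> ('a \<Rightarrow> 'b set) \<Rightarrow> ('a \<Rightarrow> 'b) set" where
  "systems_of_reps X Y A = {g \<in> X \<rightarrow>\<^sub>E Y. bij_betw g X Y \<and> (\<forall>x\<in>X. g x \<in> A x)}"

lemma bij_betw_remove:
  "bij_betw f X Y \<Longrightarrow> x \<in> X \<Longrightarrow> bij_betw f (X - {x}) (Y - {f x})"
  by (auto simp: bij_betw_def inj_on_def)

text \<open>Read \<open>j \<rightarrow> j'\<close> as "\<open>j\<close> may take over the representative of \<open>j'\<close>". Along a path from \<open>j\<close> to \<open>i\<close> every element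
  takes the representative of its successor, which releases \<open>f j\<close> and dispenses with \<open>i\<close>. Distinctness of the
  path, together with the last conjunct, ensures that \<open>j\<close> still has its original representative when its turn
  comes.\<close>

lemma shift_along_path:
  assumes f: "bij_betw f X Y" "\<And>x. x \<in> X \<Longrightarrow> f x \<in> A x"
    and "rtrancl_path (\<lambda>j j'. j \<in> X \<and> j' \<in> X \<and> f j' \<in> A j) j xs i" "distinct (j # xs)" "i \<in> X"
  shows "\<exists>g. bij_betw g (X - {i}) (Y - {f j}) \<and> (\<forall>x\<in>X - {i}. g x \<in> A x) \<and>
             (\<forall>x. x \<notin> set (j # xs) \<longrightarrow> g x = f x)"
  using assms(3-5)
proof (induction rule: rtrancl_path.induct)
  case (base j)
  have "bij_betw f (X - {j}) (Y - {f j})"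
    using f(1) base(2) by (rule bij_betw_remove)
  then show ?case using f by blast
next
  case (step j j' xs i)
  then obtain g where g: "bij_betw g (X - {i}) (Y - {f j'})" "\<forall>x\<in>X - {i}. g x \<in> A x"
      "\<forall>x. x \<notin> set (j' # xs) \<longrightarrow> g x = f x" by auto
  have ji: "j \<noteq> i"
  proof -
    have "i \<in> set (j' # xs)" using step(2) by (induction rule: rtrancl_path.induct) auto
    then show ?thesis using step by auto
  qed
  have j: "j \<in> X" "j' \<in> X" "f j' \<in> A j" "j \<noteq> j'" using step by auto
  have gj: "g j = f j" using g(3) step by auto
  have fj: "f j \<in> Y" "f j' \<in> Y" "f j \<noteq> f j'" using f j by (auto simp: bij_betw_def inj_on_def)
  have "bij_betw g (X - {i} - {j}) (Y - {f j'} - {f j})"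
    using bij_betw_remove[OF g(1), of j] gj ji j by simp
  then have "bij_betw (g(j := f j')) (X - {i} - {j}) (Y - {f j'} - {f j})"
    by (subst bij_betw_cong[where g = g]) auto
  from bij_betw_combine[OF this, of "{j}" "{f j'}"]
  have "bij_betw (g(j := f j')) (X - {i} - {j} \<union> {j}) (Y - {f j'} - {f j} \<union> {f j'})"
    by auto
  moreover have "X - {i} - {j} \<union> {j} = X - {i}" "Y - {f j'} - {f j} \<union> {f j'} = Y - {f j}"
    using ji j fj by auto
  ultimately have "bij_betw (g(j := f j')) (X - {i}) (Y - {f j})" by simp
  moreover have "\<forall>x\<in>X - {i}. (g(j := f j')) x \<in> A x" using g j by auto
  moreover have "\<forall>x. x \<notin> set (j # j' # xs) \<longrightarrow> (g(j := f j')) x = f x" using g by auto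
  ultimately show ?case by blast
qed

text \<open>Choose \<open>i\<close> with the fewest elements reachable from it in the digraph just described. Every element
  reachable from \<open>i\<close> then reaches \<open>i\<close> in turn, so each choice \<open>y\<close> for \<open>i\<close> can be repaired by a shift along
  a path from the former owner of \<open>y\<close> back to \<open>i\<close>.\<close>

lemma flexible_element:
  assumes f: "bij_betw f X Y" "\<And>x. x \<in> X \<Longrightarrow> f x \<in> A x"
    and X: "finite X" "X \<noteq> {}" and A: "\<And>x. x \<in> X \<Longrightarrow> A x \<subseteq> Y"
  obtains i where "i \<in> X"
    "\<And>y. y \<in> A i \<Longrightarrow> \<exists>g. bij_betw g (X - {i}) (Y - {y}) \<and> (\<forall>x\<in>X - {i}. g x \<in> A x)"
proof -
  let ?r = "\<lambda>j j'. j \<in> X \<and> j' \<in> X \<and> f j' \<in> A j"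
  define R where "R = (\<lambda>i. {j. rtranclp ?r i j})"
  have RX: "R i \<subseteq> X" if "i \<in> X" for i
  proof
    fix j assume "j \<in> R i"
    then have "rtranclp ?r i j" by (simp add: R_def)
    then show "j \<in> X" using that by (induction rule: rtranclp_induct) auto
  qed
  obtain i where i: "i \<in> X" "\<And>j. j \<in> X \<Longrightarrow> card (R i) \<le> card (R j)"
    using X ex_min_if_finite[of "(\<lambda>i. card (R i)) ` X"] by (fastforce simp: not_less)
  have return_path: "rtranclp ?r j i" if "rtranclp ?r i j" for j
  proof -
    have "R j \<subseteq> R i" using that by (auto simp: R_def)
    moreover have "j \<in> X" using RX[OF i(1)] that by (auto simp: R_def)
    ultimately have "R j = R i"
      using i X RX by (meson card_seteq finite_subset)
    then show ?thesis by (auto simp: R_def)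
  qed
  show ?thesis
  proof (rule that[OF i(1)])
    fix y assume y: "y \<in> A i"
    then obtain j where j: "j \<in> X" "f j = y"
      using A[OF i(1)] f(1) by (auto simp: bij_betw_def)
    then have "rtranclp ?r i j" using i y by auto
    then obtain xs0 where "rtrancl_path ?r j xs0 i"
      using return_path by (auto simp: rtranclp_eq_rtrancl_path)
    then obtain xs where xs: "rtrancl_path ?r j xs i" "distinct (j # xs)"
      by (rule rtrancl_path_distinct)
    from shift_along_path[OF f xs i(1)] j
    show "\<exists>g. bij_betw g (X - {i}) (Y - {y}) \<and> (\<forall>x\<in>X - {i}. g x \<in> A x)" by auto
  qed
qed

lemma finite_systems_of_reps: "finite X \<Longrightarrow> finite Y \<Longrightarrow> finite (systems_of_reps X Y A)"
  by (rule finite_subset[of _ "X \<rightarrow>\<^sub>E Y"]) (auto simp: systems_of_reps_def intro: finite_PiE)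

text \<open>Marshall Hall's lower bound. A flexible element has at least \<open>k\<close> choices; each leaves a smaller system that
  still has a system of representatives and whose sets lose at most one element.\<close>

proposition marshall_hall_count:
  assumes "bij_betw f X Y" "\<And>x. x \<in> X \<Longrightarrow> f x \<in> A x" "finite X"
    and "\<And>x. x \<in> X \<Longrightarrow> A x \<subseteq> Y" "\<And>x. x \<in> X \<Longrightarrow> k \<le> card (A x)" "k \<le> card X"
  shows "fact k \<le> card (systems_of_reps X Y A)"
  using assms
proof (induction k arbitrary: X Y A f)
  case 0
  have "bij_betw (restrict f X) X Y" using 0(1) by simp
  then have "restrict f X \<in> systems_of_reps X Y A"
    using 0(1,2) by (auto simp: systems_of_reps_def bij_betw_def)
  moreover have "finite Y" using 0 bij_betw_finite by blast
  ultimately show ?case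
    using finite_systems_of_reps[OF 0(3), of Y A] by (simp add: Suc_le_eq card_gt_0_iff) blast
next
  case (Suc k)
  have "X \<noteq> {}" using Suc.prems(6) by auto
  have fY: "finite Y" using Suc.prems(1,3) bij_betw_finite by blast
  obtain i where i: "i \<in> X"
    "\<And>y. y \<in> A i \<Longrightarrow> \<exists>g. bij_betw g (X - {i}) (Y - {y}) \<and> (\<forall>x\<in>X - {i}. g x \<in> A x)"
    using flexible_element[OF Suc.prems(1,2) Suc.prems(3) \<open>X \<noteq> {}\<close> Suc.prems(4)] by metis
  define T where "T = (\<lambda>y. (\<lambda>g. g(i := y)) ` systems_of_reps (X - {i}) (Y - {y}) (\<lambda>x. A x - {y}))"
  have T: "fact k \<le> card (T y)" if y: "y \<in> A i" for y
  proof -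
    obtain g where g: "bij_betw g (X - {i}) (Y - {y})" "\<forall>x\<in>X - {i}. g x \<in> A x"
      using i(2)[OF y] by blast
    have "fact k \<le> card (systems_of_reps (X - {i}) (Y - {y}) (\<lambda>x. A x - {y}))"
    proof (rule Suc.IH[OF g(1)])
      show "g x \<in> A x - {y}" if "x \<in> X - {i}" for x
        using g that by (auto simp: bij_betw_def)
      show "k \<le> card (A x - {y})" if "x \<in> X - {i}" for x
        using Suc.prems(5)[of x] that diff_card_le_card_Diff[of "{y}" "A x"] by simp
      show "A x - {y} \<subseteq> Y - {y}" if "x \<in> X - {i}" for x using Suc.prems(4)[of x] that by auto
    qed (use Suc.prems(3,6) i(1) in auto)
    also have "\<dots> = card (T y)"
      unfolding T_def
    proof (rule card_image[symmetric], rule inj_onI)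
      fix g h assume gh: "g \<in> systems_of_reps (X - {i}) (Y - {y}) (\<lambda>x. A x - {y})"
        "h \<in> systems_of_reps (X - {i}) (Y - {y}) (\<lambda>x. A x - {y})" "g(i := y) = h(i := y)"
      then have "g i = undefined" "h i = undefined" by (auto simp: systems_of_reps_def PiE_def extensional_def)
      then show "g = h" using gh(3) by (metis fun_upd_triv fun_upd_upd)
    qed
    finally show ?thesis .
  qed
  have sub: "T y \<subseteq> systems_of_reps X Y A" if y: "y \<in> A i" for y
  proof
    fix h assume "h \<in> T y"
    then obtain g where h: "h = g(i := y)" and g: "g \<in> systems_of_reps (X - {i}) (Y - {y}) (\<lambda>x. A x - {y})"
      by (auto simp: T_def)
    have yY: "y \<in> Y" using y Suc.prems(4) i(1) by auto
    have "bij_betw g (X - {i}) (Y - {y})" using g by (simp add: systems_of_reps_def)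
    then have "bij_betw h (X - {i}) (Y - {y})"
      unfolding h by (subst bij_betw_cong[where g = g]) auto
    from bij_betw_combine[OF this, of "{i}" "{y}"]
    have "bij_betw h (X - {i} \<union> {i}) (Y - {y} \<union> {y})" by (auto simp: h)
    moreover have "X - {i} \<union> {i} = X" "Y - {y} \<union> {y} = Y" using i(1) yY by auto
    ultimately have "bij_betw h X Y" by simp
    moreover have "\<forall>x\<in>X. h x \<in> A x" using g y by (auto simp: h systems_of_reps_def)
    moreover have "h \<in> X \<rightarrow>\<^sub>E Y"
      using g yY i(1) by (auto simp: h systems_of_reps_def PiE_def extensional_def)
    ultimately show "h \<in> systems_of_reps X Y A" by (simp add: systems_of_reps_def)
  qed
  have fA: "finite (A i)" using Suc.prems(4) i(1) fY finite_subset by blast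
  have fT: "finite (T y)" if "y \<in> A i" for y
    using sub[OF that] finite_systems_of_reps[OF Suc.prems(3) fY] finite_subset by blast
  have "fact (Suc k) = Suc k * fact k" by simp
  also have "\<dots> \<le> card (A i) * fact k" using Suc.prems(5)[OF i(1)] by (rule mult_right_mono) simp
  also have "\<dots> = (\<Sum>y\<in>A i. fact k)" by simp
  also have "\<dots> \<le> (\<Sum>y\<in>A i. card (T y))" using T by (rule sum_mono)
  also have "\<dots> = card (\<Union>y\<in>A i. T y)"
  proof (rule card_UN_disjoint[symmetric])
    show "\<forall>y\<in>A i. \<forall>z\<in>A i. y \<noteq> z \<longrightarrow> T y \<inter> T z = {}"
      by (auto simp: T_def dest: fun_cong[where x = i])
  qed (use fA fT in auto)
  also have "\<dots> \<le> card (systems_of_reps X Y A)"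
    using sub by (intro card_mono finite_systems_of_reps Suc.prems fY) auto
  finally show ?case .
qed

section \<open>Balanced choices of one end per edge\<close>

text \<open>For a fair coin with expected value \<open>\<mu>\<close> this bounds the Laplace transform by \<open>exp (- (t - t\<^sup>2) \<mu>)\<close>, stated
  with the two outcomes summed rather than averaged. The error term \<open>t\<^sup>2\<close> is far from best possible, but it follows from
  \<open>exp (- t) \<le> 1 / (1 + t)\<close> alone.\<close>

lemma coin_laplace_bound:
  fixes t :: real and P :: "bool \<Rightarrow> bool"
  assumes "0 \<le> t"
  shows "(\<Sum>b\<in>UNIV. exp (- t * of_bool (P b))) \<le> 2 * exp (- (t / 2 - t\<^sup>2 / 2) * (\<Sum>b\<in>UNIV. of_bool (P b)))"
proof -
  have "exp (- t) \<le> 1 / (1 + t)"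
    using exp_ge_add_one_self[of t] assms by (simp add: exp_minus field_simps)
  also have "\<dots> \<le> 1 - t + t\<^sup>2"
  proof -
    have "(1 - t + t\<^sup>2) * (1 + t) = 1 + t ^ 3" by (simp add: algebra_simps power2_eq_square power3_eq_cube)
    then have "1 \<le> (1 - t + t\<^sup>2) * (1 + t)" using assms by simp
    then show ?thesis using assms by (simp add: divide_le_eq)
  qed
  finally have "1 + exp (- t) \<le> 2 * (1 + - (t / 2 - t\<^sup>2 / 2))" by simp
  also have "\<dots> \<le> 2 * exp (- (t / 2 - t\<^sup>2 / 2))"
    using exp_ge_add_one_self by (rule mult_left_mono) simp
  finally have one: "1 + exp (- t) \<le> 2 * exp (- (t / 2 - t\<^sup>2 / 2))" .
  have two: "exp (- t) \<le> exp (t\<^sup>2 - t)" by simp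
  show ?thesis
    using one two by (cases "P True"; cases "P False") (simp_all add: UNIV_bool algebra_simps)
qed

text \<open>A Chernoff bound in counting form: the sum of \<open>exp (- t * X)\<close> over all choice functions factorises over
  the coordinates, and each bad choice contributes more than \<open>exp (- t * \<kappa>)\<close> to it.\<close>

lemma few_bad_choices:
  fixes N :: "('a \<times> bool) set" and t \<kappa> :: real
  assumes J: "finite J" and N: "N \<subseteq> J \<times> UNIV" and t: "0 \<le> t"
  shows "real (card {\<sigma> \<in> J \<rightarrow>\<^sub>E UNIV. real (card {j \<in> J. (j, \<sigma> j) \<in> N}) < \<kappa>})
           \<le> 2 ^ card J * exp (t * \<kappa> - (t / 2 - t\<^sup>2 / 2) * card N)"
proof -
  let ?\<Omega> = "J \<rightarrow>\<^sub>E (UNIV :: bool set)" and ?\<mu> = "t / 2 - t\<^sup>2 / 2"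
  let ?X = "\<lambda>\<sigma>. real (card {j \<in> J. (j, \<sigma> j) \<in> N})"
  let ?bad = "{\<sigma> \<in> ?\<Omega>. ?X \<sigma> < \<kappa>}"
  have fin: "finite ?\<Omega>" using J by (intro finite_PiE) auto
  have X: "?X \<sigma> = (\<Sum>j\<in>J. of_bool ((j, \<sigma> j) \<in> N))" for \<sigma>
    using J by (simp add: Int_def)
  have cN: "(\<Sum>j\<in>J. \<Sum>b\<in>UNIV. of_bool ((j, b) \<in> N)) = real (card N)"
  proof -
    have "(\<Sum>j\<in>J. \<Sum>b\<in>UNIV. of_bool ((j, b) \<in> N)) = (\<Sum>d\<in>J \<times> UNIV. of_bool (d \<in> N) :: real)"
      by (simp only: sum.cartesian_product split_def prod.collapse)
    also have "\<dots> = real (card N)"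
      using J N by (simp add: Int_absorb1 Int_absorb2 Int_def[symmetric])
    finally show ?thesis .
  qed
  have "real (card ?bad) * exp (- t * \<kappa>) = (\<Sum>\<sigma>\<in>?bad. exp (- t * \<kappa>))" by simp
  also have "\<dots> \<le> (\<Sum>\<sigma>\<in>?bad. exp (- t * ?X \<sigma>))"
    using t by (intro sum_mono) (auto intro: mult_left_mono)
  also have "\<dots> \<le> (\<Sum>\<sigma>\<in>?\<Omega>. exp (- t * ?X \<sigma>))" using fin by (intro sum_mono2) auto
  also have "\<dots> = (\<Sum>\<sigma>\<in>?\<Omega>. \<Prod>j\<in>J. exp (- t * of_bool ((j, \<sigma> j) \<in> N)))"
    by (intro sum.cong refl) (simp only: X sum_distrib_left exp_sum[OF J])
  also have "\<dots> = (\<Prod>j\<in>J. \<Sum>b\<in>UNIV. exp (- t * of_bool ((j, b) \<in> N)))"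
    using J by (subst prod_sum_PiE) auto
  also have "\<dots> \<le> (\<Prod>j\<in>J. 2 * exp (- ?\<mu> * (\<Sum>b\<in>UNIV. of_bool ((j, b) \<in> N))))"
    by (intro prod_mono conjI sum_nonneg coin_laplace_bound[OF t]) simp
  also have "\<dots> = 2 ^ card J * exp (- ?\<mu> * card N)"
    by (simp only: prod.distrib prod_constant exp_sum[OF J, symmetric] sum_distrib_left[symmetric] cN)
  finally have "real (card ?bad) * exp (- t * \<kappa>) * exp (t * \<kappa>)
      \<le> 2 ^ card J * exp (- ?\<mu> * card N) * exp (t * \<kappa>)"
    by (rule mult_right_mono) simp
  also have "\<dots> = 2 ^ card J * exp (t * \<kappa> - ?\<mu> * card N)"
    by (simp only: mult.assoc exp_add[symmetric] minus_mult_left[symmetric] uminus_add_conv_diff)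
  finally show ?thesis by (simp add: mult.assoc exp_add[symmetric])
qed

lemma good_choice_exists:
  fixes N :: "'q \<Rightarrow> ('a \<times> bool) set" and t \<kappa> d :: real
  assumes J: "finite J" and Q: "finite Q" and N: "\<And>q. q \<in> Q \<Longrightarrow> N q \<subseteq> J \<times> UNIV"
    and t: "0 \<le> t" "t \<le> 1" and d: "\<And>q. q \<in> Q \<Longrightarrow> d \<le> card (N q)"
    and small: "card Q * exp (t * \<kappa> - (t / 2 - t\<^sup>2 / 2) * d) < 1"
  shows "\<exists>\<sigma>. \<forall>q\<in>Q. \<kappa> \<le> card {j \<in> J. (j, \<sigma> j) \<in> N q}"
proof -
  let ?\<Omega> = "J \<rightarrow>\<^sub>E (UNIV :: bool set)" and ?\<mu> = "t / 2 - t\<^sup>2 / 2"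
  define bad where "bad = (\<lambda>q. {\<sigma> \<in> ?\<Omega>. real (card {j \<in> J. (j, \<sigma> j) \<in> N q}) < \<kappa>})"
  have mu: "0 \<le> ?\<mu>" using mult_left_mono[OF t(2) t(1)] by (simp add: power2_eq_square)
  have fin: "finite ?\<Omega>" using J by (intro finite_PiE) auto
  have "real (card (\<Union>q\<in>Q. bad q)) \<le> (\<Sum>q\<in>Q. real (card (bad q)))"
    using card_UN_le[OF Q, of bad] by (metis of_nat_le_iff of_nat_sum)
  also have "\<dots> \<le> (\<Sum>q\<in>Q. 2 ^ card J * exp (t * \<kappa> - ?\<mu> * d))"
  proof (rule sum_mono)
    fix q assume q: "q \<in> Q"
    have "real (card (bad q)) \<le> 2 ^ card J * exp (t * \<kappa> - ?\<mu> * card (N q))"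
      unfolding bad_def by (rule few_bad_choices[OF J N[OF q] t(1)])
    also have "\<dots> \<le> 2 ^ card J * exp (t * \<kappa> - ?\<mu> * d)"
      using mult_left_mono[OF d[OF q] mu] by simp
    finally show "real (card (bad q)) \<le> 2 ^ card J * exp (t * \<kappa> - ?\<mu> * d)" .
  qed
  also have "\<dots> = 2 ^ card J * (card Q * exp (t * \<kappa> - ?\<mu> * d))" by simp
  also have "\<dots> < 2 ^ card J * 1" using small by (intro mult_strict_left_mono) auto
  also have "\<dots> = real (card ?\<Omega>)" using J by (simp add: card_PiE)
  finally have "card (\<Union>q\<in>Q. bad q) < card ?\<Omega>" by simp
  then have "\<not> ?\<Omega> \<subseteq> (\<Union>q\<in>Q. bad q)"
    using card_mono[of "\<Union>q\<in>Q. bad q" ?\<Omega>] finite_subset[OF _ fin, of "\<Union>q\<in>Q. bad q"]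
    by (fastforce simp: bad_def)
  then obtain \<sigma> where "\<sigma> \<in> ?\<Omega>" "\<forall>q\<in>Q. \<sigma> \<notin> bad q" by blast
  then show ?thesis by (intro exI[of _ \<sigma>]) (auto simp: bad_def not_less)
qed

lemma union_bound_small:
  fixes \<delta> n :: real
  assumes "0 < \<delta>" "4 / \<delta>\<^sup>2 < n"
  shows "2 * n * exp (- (\<delta> * n)) < 1"
proof -
  have n: "0 < n" using assms by (meson divide_nonneg_nonneg le_less_trans zero_le_numeral zero_le_power2)
  have "4 < n * \<delta>\<^sup>2" using assms by (simp add: divide_less_eq)
  then have "2 * n * 2 < n * (n * \<delta>\<^sup>2)" using n by simp
  then have "2 * n < (\<delta> * n)\<^sup>2 / 2" by (simp add: power2_eq_square algebra_simps)
  also have "\<dots> < exp (\<delta> * n)"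
    using exp_lower_Taylor_quadratic[of "\<delta> * n"] mult_pos_pos[OF assms(1) n] by linarith
  finally show ?thesis by (simp add: exp_minus field_simps)
qed

section \<open>Counting perfect matching transversals\<close>

lemma nbrs_card_eq_degree:
  assumes "\<And>e. e \<in> edges G \<Longrightarrow> card e = 2"
  shows "degree G v = card {u. {v, u} \<in> edges G}"
proof -
  have "bij_betw (\<lambda>u. {v, u}) {u. {v, u} \<in> edges G} {e \<in> edges G. v \<in> e}"
  proof (rule bij_betw_imageI)
    show "inj_on (\<lambda>u. {v, u}) {u. {v, u} \<in> edges G}"
      by (auto simp: inj_on_def doubleton_eq_iff)
    show "(\<lambda>u. {v, u}) ` {u. {v, u} \<in> edges G} = {e \<in> edges G. v \<in> e}"
    proof (intro equalityI subsetI)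
      fix e assume "e \<in> {e \<in> edges G. v \<in> e}"
      then have e: "e \<in> edges G" "v \<in> e" "card e = 2" using assms by auto
      then obtain u where "e = {v, u}" by (auto simp: card_2_iff)
      then show "e \<in> (\<lambda>u. {v, u}) ` {u. {v, u} \<in> edges G}" using e by auto
    qed auto
  qed
  then show ?thesis by (simp add: degree_def bij_betw_same_card)
qed

lemma finite_perfect_matching_transversals:
  assumes "finite (edges G)"
  shows "finite (perfect_matching_transversals G n \<G>)"
proof (rule finite_subset)
  show "perfect_matching_transversals G n \<G> \<subseteq> (SIGMA T : Pow (edges G). T \<rightarrow>\<^sub>E {1..n})"
    by (auto simp: perfect_matching_transversals_def transversal_def)
  show "finite (SIGMA T : Pow (edges G). T \<rightarrow>\<^sub>E {1..n})"
    using assms by (intro finite_SigmaI finite_PiE) (auto intro: finite_subset)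
qed

text \<open>With the end \<open>a i\<close> of the edge of colour \<open>i\<close> held fixed, a reassignment \<open>\<pi>\<close> of the other ends gives the
  transversal with edges \<open>{a i, b (\<pi> i)}\<close> of colour \<open>i\<close>. Different \<open>\<pi>\<close> give different transversals, because the
  colouring recovers the edge of each colour and this edge determines \<open>b (\<pi> i)\<close>.\<close>

lemma card_reps_le_transversals:
  fixes a b :: "nat \<Rightarrow> 'a"
  assumes V: "finite V" and sub: "\<And>i. i \<in> {1..n} \<Longrightarrow> edges (\<G> i) \<subseteq> edges (complete_graph V)"
    and a: "inj_on a {1..n}" and b: "inj_on b {1..n}"
    and ab: "a ` {1..n} \<inter> b ` {1..n} = {}" "a ` {1..n} \<union> b ` {1..n} = V"
  shows "card (systems_of_reps {1..n} {1..n} (\<lambda>i. {j \<in> {1..n}. {a i, b j} \<in> edges (\<G> i)}))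
           \<le> card (perfect_matching_transversals (complete_graph V) n \<G>)"
proof -
  let ?C = "{1..n}" and ?A = "\<lambda>i. {j \<in> {1..n}. {a i, b j} \<in> edges (\<G> i)}"
  let ?e = "\<lambda>\<pi> i. {a i, b (\<pi> i)}"
  let ?\<Phi> = "\<lambda>\<pi>. (?e \<pi> ` ?C, restrict (inv_into ?C (?e \<pi>)) (?e \<pi> ` ?C))"
  have ne: "a i \<noteq> b j" if "i \<in> ?C" "j \<in> ?C" for i j using ab(1) that by blast
  have reps: "\<pi> i \<in> ?C" "?e \<pi> i \<in> edges (\<G> i)" if "\<pi> \<in> systems_of_reps ?C ?C ?A" "i \<in> ?C" for \<pi> i
    using that by (auto simp: systems_of_reps_def)
  have inj: "inj_on (?e \<pi>) ?C" if "\<pi> \<in> systems_of_reps ?C ?C ?A" for \<pi>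
  proof (rule inj_onI)
    fix i j assume ij: "i \<in> ?C" "j \<in> ?C" "?e \<pi> i = ?e \<pi> j"
    then have "a i = a j" using ne[of i "\<pi> j"] reps(1)[OF that] by (auto simp: doubleton_eq_iff)
    then show "i = j" using inj_onD[OF a _ ij(1,2)] by simp
  qed
  have "inj_on ?\<Phi> (systems_of_reps ?C ?C ?A)"
  proof (rule inj_onI)
    fix \<pi> \<rho> assume \<pi>: "\<pi> \<in> systems_of_reps ?C ?C ?A" and \<rho>: "\<rho> \<in> systems_of_reps ?C ?C ?A"
      and eq: "?\<Phi> \<pi> = ?\<Phi> \<rho>"
    show "\<pi> = \<rho>"
    proof (rule PiE_ext)
      show "\<pi> \<in> ?C \<rightarrow>\<^sub>E ?C" "\<rho> \<in> ?C \<rightarrow>\<^sub>E ?C" using \<pi> \<rho> by (auto simp: systems_of_reps_def)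
    next
      fix i assume i: "i \<in> ?C"
      have im: "?e \<pi> ` ?C = ?e \<rho> ` ?C"
        and inv: "restrict (inv_into ?C (?e \<pi>)) (?e \<pi> ` ?C) = restrict (inv_into ?C (?e \<rho>)) (?e \<rho> ` ?C)"
        using eq unfolding prod.inject by blast+
      have mem: "?e \<pi> i \<in> ?e \<pi> ` ?C" using i by (rule imageI)
      note mem' = mem[unfolded im]
      from mem' have "?e \<rho> (inv_into ?C (?e \<rho>) (?e \<pi> i)) = ?e \<pi> i" by (rule f_inv_into_f)
      moreover have "inv_into ?C (?e \<rho>) (?e \<pi> i) = inv_into ?C (?e \<pi>) (?e \<pi> i)"
        using fun_cong[OF inv, of "?e \<pi> i"] by (simp only: restrict_apply' mem mem')
      moreover have "inv_into ?C (?e \<pi>) (?e \<pi> i) = i" using inv_into_f_f[OF inj[OF \<pi>] i] .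
      ultimately have "?e \<rho> i = ?e \<pi> i" by simp
      then have "b (\<pi> i) = b (\<rho> i)" by (auto simp: doubleton_eq_iff)
      then show "\<pi> i = \<rho> i" using inj_onD[OF b _ reps(1)[OF \<pi> i] reps(1)[OF \<rho> i]] by simp
    qed
  qed
  moreover have "?\<Phi> ` systems_of_reps ?C ?C ?A \<subseteq> perfect_matching_transversals (complete_graph V) n \<G>"
  proof
    fix X assume "X \<in> ?\<Phi> ` systems_of_reps ?C ?C ?A"
    then obtain \<pi> where \<pi>: "\<pi> \<in> systems_of_reps ?C ?C ?A" and X: "X = ?\<Phi> \<pi>" by blast
    let ?T = "?e \<pi> ` ?C"
    have T: "?T \<subseteq> edges (complete_graph V)" using reps(2)[OF \<pi>] sub by blast
    have bij: "bij_betw (inv_into ?C (?e \<pi>)) ?T ?C"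
      using inj[OF \<pi>] by (simp add: bij_betw_inv_into inj_on_imp_bij_betw)
    have "transversal (complete_graph V) n \<G> X"
      using T bij reps(2)[OF \<pi>] inv_into_f_f[OF inj[OF \<pi>]]
      by (auto simp: transversal_def X bij_betw_def inv_into_into)
    moreover have "perfect_matching_on V ?T"
      unfolding perfect_matching_on_def
    proof (intro conjI ballI)
      show "e \<subseteq> V" "card e = 2" if "e \<in> ?T" for e
        using T that by (auto simp: complete_graph_def)
      have bij\<pi>: "bij_betw \<pi> ?C ?C" using \<pi> by (simp add: systems_of_reps_def)
      fix v assume "v \<in> V"
      then consider i where "i \<in> ?C" "v = a i" | j where "j \<in> ?C" "v = b j" using ab(2) by blast
      then show "\<exists>!e. e \<in> ?T \<and> v \<in> e"
      proof cases
        case 1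
        show ?thesis
        proof (rule ex1I[of _ "?e \<pi> i"])
          fix e assume "e \<in> ?T \<and> v \<in> e"
          then obtain j where j: "j \<in> ?C" "e = ?e \<pi> j" "v \<in> e" by blast
          then have "a i = a j" using 1 ne[OF 1(1) reps(1)[OF \<pi> j(1)]] by auto
          then have "i = j" by (rule inj_onD[OF a _ 1(1) j(1)])
          then show "e = ?e \<pi> i" using j(2) by simp
        qed (use 1 in auto)
      next
        case 2
        obtain i where i: "i \<in> ?C" "\<pi> i = j" using bij\<pi> 2(1) by (metis bij_betw_def imageE)
        show ?thesis
        proof (rule ex1I[of _ "?e \<pi> i"])
          fix e assume "e \<in> ?T \<and> v \<in> e"
          then obtain l where l: "l \<in> ?C" "e = ?e \<pi> l" "v \<in> e" by blast
          then have "b j = b (\<pi> l)" using 2 ne[OF l(1) 2(1)] by auto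
          then have "\<pi> i = \<pi> l" using inj_onD[OF b _ 2(1) reps(1)[OF \<pi> l(1)]] i(2) by simp
          then have "i = l" using inj_onD[OF bij_betw_imp_inj_on[OF bij\<pi>] _ i(1) l(1)] by simp
          then show "e = ?e \<pi> i" using l by simp
        qed (use 2 i in auto)
      qed
    qed
    ultimately show "X \<in> perfect_matching_transversals (complete_graph V) n \<G>"
      by (simp add: perfect_matching_transversals_def X complete_graph_def)
  qed
  moreover have "finite (edges (complete_graph V))"
    using V by (auto simp: complete_graph_def intro: finite_subset[of _ "Pow V"])
  ultimately show ?thesis
    by (intro card_inj_on_le[of ?\<Phi>]) (auto intro: finite_perfect_matching_transversals)
qed

theorem theorem1p5:
  fixes \<epsilon> c :: real
  assumes "\<epsilon> > 0" and "c \<ge> 1"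
  shows "\<exists>n\<^sub>0::nat. \<forall>n\<ge>n\<^sub>0. \<forall>\<G> :: nat \<Rightarrow> nat graph.
    (\<forall>i\<in>{1..n}. spanning_subgraph (\<G> i) (complete_graph {1..2 * n}) \<and>
                real (min_degree (\<G> i)) \<ge> c * real n) \<longrightarrow>
    card (perfect_matching_transversals (complete_graph {1..2 * n}) n \<G>)
      \<ge> fact (nat \<lfloor>c * real n / (2 + \<epsilon>)\<rfloor>)"
proof -
  \<comment> \<open>With this \<open>t\<close> the target \<open>c n / (2 + \<epsilon>)\<close> equals \<open>(1 / 2 - t) c n\<close>, so the gap \<open>t c n\<close> below the expected
    value beats the quadratic error of the Chernoff bound, and the exponent becomes \<open>- \<delta> n\<close>.\<close>
  define t where "t = \<epsilon> / (2 * (2 + \<epsilon>))"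
  have t: "0 < t" "t \<le> 1" "1 / (2 + \<epsilon>) = 1 / 2 - t"
    using assms(1) by (auto simp: t_def field_simps)
  define \<delta> where "\<delta> = c * t\<^sup>2 / 2"
  have \<delta>: "0 < \<delta>" using t assms(2) by (simp add: \<delta>_def)
  define n0 where "n0 = nat \<lceil>4 / \<delta>\<^sup>2\<rceil> + 1"
  show ?thesis
  proof (intro exI[of _ n0] allI impI)
    fix n :: nat and \<G> :: "nat \<Rightarrow> nat graph"
    let ?C = "{1..n}" and ?V = "{1..2 * n}"
    assume n: "n0 \<le> n" and \<G>: "\<forall>i\<in>?C. spanning_subgraph (\<G> i) (complete_graph ?V) \<and>
      real (min_degree (\<G> i)) \<ge> c * real n"
    define E where "E = (\<lambda>i. edges (\<G> i))"
    have large: "4 / \<delta>\<^sup>2 < real n" "1 \<le> n" using n unfolding n0_def by linarith+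
    have sub: "E i \<subseteq> edges (complete_graph ?V)" "verts (\<G> i) = ?V" if "i \<in> ?C" for i
      using \<G> that by (auto simp: spanning_subgraph_def E_def complete_graph_def)
    have two: "e \<subseteq> ?V \<and> card e = 2" if "i \<in> ?C" "e \<in> E i" for i e
      using sub(1)[OF that(1)] that(2) by (auto simp: complete_graph_def)
    have deg: "c * n \<le> card (nbrs E i v)" if i: "i \<in> ?C" and v: "v \<in> ?V" for i v
    proof -
      have "min_degree (\<G> i) \<le> degree (\<G> i) v"
        unfolding min_degree_def sub(2)[OF i] using v by (intro Min_le) auto
      also have "\<dots> = card (nbrs E i v)"
        using nbrs_card_eq_degree[of "\<G> i" v] two[OF i] by (simp add: nbrs_def E_def)
      finally show ?thesis using \<G> i by fastforce
    qed
    interpret dirac_family E ?V ?C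
    proof
      fix i v assume "i \<in> ?C" "v \<in> ?V"
      then have "real n \<le> c * n" "c * n \<le> card (nbrs E i v)"
        using deg assms(2) by (auto simp: mult_le_cancel_right1)
      then show "card ?C \<le> card (nbrs E i v)" by simp
    qed (use two in auto)
    obtain m where m: "rainbow_by E m ?V ?C"
      using rainbow_perfect_matching by (auto simp: rainbow_def)
    \<comment> \<open>The requirement for the vertex \<open>m i s\<close> in colour \<open>i\<close>: many of the chosen ends \<open>m j (\<sigma> j)\<close> are its
      neighbours in this colour. Imposing it for both ends \<open>s\<close> keeps the events free of any condition on \<open>\<sigma> i\<close>.\<close>
    define N where "N = (\<lambda>(i, s). {(j, b) \<in> ?C \<times> UNIV. m j b \<in> nbrs E i (m i s)})"
    let ?\<kappa> = "c * n / (2 + \<epsilon>)"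
    have cN: "c * n \<le> card (N q)" if q: "q \<in> ?C \<times> UNIV" for q
    proof -
      obtain i s where [simp]: "q = (i, s)" by fastforce
      have "nbrs E i (m i s) \<inter> ?V = nbrs E i (m i s)"
        using nbrs_subset[of i] q by auto
      then show ?thesis
        using deg[of i "m i s"] rainbow_by_mem[OF m, of i s] q
          rainbow_by_card_vertices[OF m, of "nbrs E i (m i s)"] by (simp add: N_def)
    qed
    have "t * ?\<kappa> - (t / 2 - t\<^sup>2 / 2) * (c * n) = - (\<delta> * n)"
    proof -
      have \<kappa>: "?\<kappa> = c * n * (1 / 2 - t)" unfolding t(3)[symmetric] by simp
      show ?thesis unfolding \<kappa> by (simp add: \<delta>_def algebra_simps power2_eq_square)
    qed
    then have small: "card (?C \<times> (UNIV :: bool set)) * exp (t * ?\<kappa> - (t / 2 - t\<^sup>2 / 2) * (c * n)) < 1"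
      using union_bound_small[OF \<delta> large(1)] by (simp add: card_cartesian_product mult.commute)
    have N: "N q \<subseteq> ?C \<times> UNIV" if "q \<in> ?C \<times> UNIV" for q by (auto simp: N_def)
    have fin: "finite ?C" "finite (?C \<times> (UNIV :: bool set))" by simp_all
    obtain \<sigma> where \<sigma>: "\<forall>q\<in>?C \<times> UNIV. ?\<kappa> \<le> card {j \<in> ?C. (j, \<sigma> j) \<in> N q}"
      using good_choice_exists[where Q = "?C \<times> UNIV" and N = N,
          OF fin N less_imp_le[OF t(1)] t(2) cN small] by blast
    define a b where "a = (\<lambda>i. m i (\<not> \<sigma> i))" and "b = (\<lambda>i. m i (\<sigma> i))"
    let ?A = "\<lambda>i. {j \<in> ?C. {a i, b j} \<in> edges (\<G> i)}"
    let ?k = "nat \<lfloor>?\<kappa>\<rfloor>"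
    have k: "?k \<le> card (?A i)" if i: "i \<in> ?C" for i
    proof -
      have "{j \<in> ?C. (j, \<sigma> j) \<in> N (i, \<not> \<sigma> i)} = ?A i"
        by (auto simp: N_def nbrs_def E_def a_def b_def)
      then have "?\<kappa> \<le> card (?A i)" using bspec[OF \<sigma>, of "(i, \<not> \<sigma> i)"] i by simp
      then show ?thesis by linarith
    qed
    have "card (?A 1) \<le> card ?C" by (intro card_mono) auto
    then have kn: "?k \<le> card ?C" using k[of 1] large(2) by simp
    have "fact ?k \<le> card (systems_of_reps ?C ?C ?A)"
    proof (rule marshall_hall_count[where f = id])
      show "id i \<in> ?A i" if "i \<in> ?C" for i
        using rainbow_by_edge[OF m that, of "\<sigma> i"] that by (simp add: a_def b_def E_def insert_commute)
    qed (use k kn in auto)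
    also have "\<dots> \<le> card (perfect_matching_transversals (complete_graph ?V) n \<G>)"
    proof (rule card_reps_le_transversals)
      show "inj_on a ?C" "inj_on b ?C" "a ` ?C \<inter> b ` ?C = {}"
        using rainbow_by_eq_iff[OF m] by (auto simp: inj_on_def a_def b_def)
      show "a ` ?C \<union> b ` ?C = ?V"
      proof
        show "a ` ?C \<union> b ` ?C \<subseteq> ?V" using rainbow_by_mem[OF m] by (auto simp: a_def b_def)
        show "?V \<subseteq> a ` ?C \<union> b ` ?C"
        proof
          fix v assume "v \<in> ?V"
          then obtain i s where "i \<in> ?C" "v = m i s" by (rule rainbow_by_surj[OF m])
          then show "v \<in> a ` ?C \<union> b ` ?C" by (cases "s = \<sigma> i") (auto simp: a_def b_def)
        qed
      qed
    qed (use sub in \<open>auto simp: E_def\<close>)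
    finally show "fact (nat \<lfloor>c * real n / (2 + \<epsilon>)\<rfloor>)
        \<le> card (perfect_matching_transversals (complete_graph ?V) n \<G>)" .
  qed
qed

end
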